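(* Let $l\le k$ be nonnegative integers and let $\tau\in B_l$. Let $P=\tau(l+1)(l+2)\ldots k\in B_k$ and $Q=\bar{\tau}(l+1)(l+2)\ldots k\in B_k$. Then $P$ and $Q$ are Wilf equivalent, i.e. $|B_n(P)|=|B_n(Q)|$ for all $n\ge 1$. Moreover, $|SI_n(P)|=|SI_n(Q)|$ for all $n\ge1$.
   Context: $B_n$ is the set of signed permutations of $[n]=\{1,\dots,n\}$, written as words $\pi=\pi_1\cdots\pi_n$ in which each of $1,\dots,n$ appears exactly once, possibly barred (barred = negative, unbarred = positive). $|\pi_i|$ denotes the underlying unsigned value. For $\pi\in B_n$, $\bar{\pi}$ is obtained by changing the sign of every entry. A signed permutation $\pi\in B_n$ contains $\tau\in B_k$ if there are indices $i_1<\dots<i_k$ such that for all $a,b\in[k]$: $|\pi_{i_a}|<|\pi_{i_b}|$ iff $|\tau_a|<|\tau_b|$, and $\pi_{i_a}$ is positive iff $\tau_a$ is positive; otherwise $\pi$ avoids $\tau$. $M(\tau)$ denotes the set of elements of $M$ avoiding $\tau$. $SI_n\subseteq B_n$ is the set of signed involutions, i.e. signed permutations $\pi$ which, viewed as bijections of $\{\pm1,\dots,\pm n\}$ with $\pi(-i)=-\pi(i)$, satisfy $\pi\circ\pi=\mathrm{id}$. The word $\tau(l+1)(l+2)\ldots k$ denotes the concatenation of the word $\tau$ (on values $1,\dots,l$) with the unbarred letters $l+1,\dots,k$. *)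

theory Defs
  imports Main
begin

text \<open>A signed permutation is its word, as a list of integers; a barred letter is a negative
  integer. List positions count from 0, so \<open>\<pi>\<^sub>i\<close> is \<open>\<pi> ! (i - 1)\<close>.\<close>

definition signed_perms :: "nat \<Rightarrow> int list set" where
  "signed_perms n =
     {\<pi>. length \<pi> = n \<and> distinct (map abs \<pi>) \<and> set (map abs \<pi>) = {1..int n}}"

definition bar :: "int list \<Rightarrow> int list" where
  "bar \<pi> = map uminus \<pi>"

definition sp_contains :: "int list \<Rightarrow> int list \<Rightarrow> bool" where
  "sp_contains \<pi> \<tau> \<longleftrightarrow>
     (\<exists>f :: nat \<Rightarrow> nat.
        strict_mono_on {..<length \<tau>} f \<and> f ` {..<length \<tau>} \<subseteq> {..<length \<pi>} \<and>
        (\<forall>a < length \<tau>. \<forall>b < length \<tau>.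
           (\<bar>\<pi> ! f a\<bar> < \<bar>\<pi> ! f b\<bar> \<longleftrightarrow> \<bar>\<tau> ! a\<bar> < \<bar>\<tau> ! b\<bar>)) \<and>
        (\<forall>a < length \<tau>. \<pi> ! f a > 0 \<longleftrightarrow> \<tau> ! a > 0))"

definition avoiders :: "int list set \<Rightarrow> int list \<Rightarrow> int list set" where
  "avoiders M \<tau> = {\<pi> \<in> M. \<not> sp_contains \<pi> \<tau>}"

text \<open>The odd extension of a word to \<open>{\<plusminus>1, \<dots>, \<plusminus>n}\<close>; the value at 0 is irrelevant.\<close>

definition sp_fun :: "int list \<Rightarrow> int \<Rightarrow> int" where
  "sp_fun \<pi> i = (if i > 0 then \<pi> ! (nat i - 1) else - (\<pi> ! (nat (- i) - 1)))"

definition signed_involutions :: "nat \<Rightarrow> int list set" where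
  "signed_involutions n =
     {\<pi> \<in> signed_perms n. \<forall>i \<in> {- int n..int n} - {0}. sp_fun \<pi> (sp_fun \<pi> i) = i}"

definition wilf_equivalent :: "int list \<Rightarrow> int list \<Rightarrow> bool" where
  "wilf_equivalent P Q \<longleftrightarrow>
     (\<forall>n\<ge>1. card (avoiders (signed_perms n) P) = card (avoiders (signed_perms n) Q))"

lemma finite_signed_perms: "finite (signed_perms n)"
proof (rule finite_subset)
  show "signed_perms n \<subseteq> {\<pi>. set \<pi> \<subseteq> {- int n..int n} \<and> length \<pi> = n}"
    by (force simp: signed_perms_def)
  show "finite {\<pi>. set \<pi> \<subseteq> {- int n..int n} \<and> length \<pi> = n}"
    by (rule finite_lists_length_eq) simp
qed

lemma bar_signed_perms: "\<tau> \<in> signed_perms l \<Longrightarrow> bar \<tau> \<in> signed_perms l"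
  by (simp add: signed_perms_def bar_def comp_def image_image)

lemma append_signed_perms:
  assumes "l \<le> k" and "\<tau> \<in> signed_perms l"
  shows "\<tau> @ [int l + 1..int k] \<in> signed_perms k"
proof -
  have "map abs [int l + 1..int k] = [int l + 1..int k]"
    by (rule map_idI) auto
  moreover have "{1..int l} \<union> {int l + 1..int k} = {1..int k}"
    using assms(1) by auto
  ultimately show ?thesis
    using assms by (auto simp: signed_perms_def simp del: set_map)
qed

end

theory Submission
  imports Defs
begin

text \<open>Write \<open>P = \<tau> \<oplus> \<rho>\<close> with \<open>\<rho> = 1 2 \<dots> (k - l)\<close>; the argument works for every signed permutation
  \<open>\<rho>\<close>. Draw a word as the cells \<open>(p, \<bar>\<pi>\<^sub>p\<bar>)\<close> and call a cell covered if \<open>\<rho>\<close> occurs strictly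
  north-east of it. A copy of \<open>\<tau> \<oplus> \<rho>\<close> is a copy of \<open>\<tau>\<close> strictly south-west of a copy of \<open>\<rho>\<close>, so
  all letters of the copy of \<open>\<tau>\<close> are covered. Moving north-east as long as possible, the copy of \<open>\<rho>\<close>
  can be chosen among the uncovered letters. Hence changing the sign of every covered letter
  preserves the covered cells, is an involution, and turns copies of \<open>\<tau> \<oplus> \<rho>\<close> into copies of
  \<open>bar \<tau> \<oplus> \<rho>\<close>. If \<open>\<rho>\<close> is a signed involution, then the covered cells of a signed involution are
  symmetric about the diagonal, so sign changing also preserves signed involutions.\<close>

section \<open>Occurrences of patterns\<close>

definition same_pattern :: "int list \<Rightarrow> int list \<Rightarrow> bool" where
  "same_pattern xs ys \<longleftrightarrow> length xs = length ys \<and>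
     (\<forall>(x, y) \<in> set (zip xs ys).
        (0 < x \<longleftrightarrow> 0 < y) \<and> (\<forall>(x', y') \<in> set (zip xs ys). \<bar>x\<bar> < \<bar>x'\<bar> \<longleftrightarrow> \<bar>y\<bar> < \<bar>y'\<bar>))"

definition occurs_at :: "int list \<Rightarrow> int list \<Rightarrow> nat list \<Rightarrow> bool" where
  "occurs_at \<pi> \<tau> ps \<longleftrightarrow>
     sorted_wrt (<) ps \<and> set ps \<subseteq> {..<length \<pi>} \<and> same_pattern (map ((!) \<pi>) ps) \<tau>"

definition south_west :: "int list \<Rightarrow> nat \<Rightarrow> nat \<Rightarrow> bool" where
  "south_west \<pi> p q \<longleftrightarrow> p < q \<and> \<bar>\<pi> ! p\<bar> < \<bar>\<pi> ! q\<bar>"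

definition direct_sum :: "int list \<Rightarrow> int list \<Rightarrow> int list" (infixr "\<oplus>" 65) where
  "\<tau> \<oplus> \<rho> = \<tau> @ map (\<lambda>y. y + sgn y * int (length \<tau>)) \<rho>"

lemma same_pattern_iff_nth:
  "same_pattern xs ys \<longleftrightarrow> length xs = length ys \<and>
     (\<forall>a < length ys. \<forall>b < length ys. \<bar>xs ! a\<bar> < \<bar>xs ! b\<bar> \<longleftrightarrow> \<bar>ys ! a\<bar> < \<bar>ys ! b\<bar>) \<and>
     (\<forall>a < length ys. 0 < xs ! a \<longleftrightarrow> 0 < ys ! a)"
  unfolding same_pattern_def set_zip by fastforce

lemma same_pattern_bar:
  assumes "0 \<notin> set xs" "0 \<notin> set ys" "same_pattern xs ys"
  shows "same_pattern (bar xs) (bar ys)"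
proof -
  have "0 < - (xs ! a) \<longleftrightarrow> 0 < - (ys ! a)" if "a < length ys" for a
  proof -
    have "xs ! a \<noteq> 0" "ys ! a \<noteq> 0"
      using assms that unfolding same_pattern_def by (metis nth_mem)+
    then show ?thesis
      using assms(3) that by (auto simp: same_pattern_iff_nth)
  qed
  then show ?thesis
    using assms(3) by (simp add: same_pattern_iff_nth bar_def)
qed

lemma same_pattern_append:
  assumes "length xs = length \<tau>" "\<And>x y. x \<in> set \<tau> \<Longrightarrow> y \<in> set \<rho> \<Longrightarrow> \<bar>x\<bar> < \<bar>y\<bar>"
  shows "same_pattern (xs @ ys) (\<tau> @ \<rho>) \<longleftrightarrow>
    same_pattern xs \<tau> \<and> same_pattern ys \<rho> \<and> (\<forall>x \<in> set xs. \<forall>y \<in> set ys. \<bar>x\<bar> < \<bar>y\<bar>)"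
proof (cases "length ys = length \<rho>")
  case True
  let ?A = "zip xs \<tau>" and ?B = "zip ys \<rho>"
  have set_zip_append: "set (zip (xs @ ys) (\<tau> @ \<rho>)) = set ?A \<union> set ?B"
    using assms(1) by simp
  have fst_zip: "set xs = fst ` set ?A" "set ys = fst ` set ?B"
    using assms(1) True by (simp_all flip: set_map)
  have below: "\<bar>t\<bar> < \<bar>r\<bar>" if "(x, t) \<in> set ?A" "(y, r) \<in> set ?B" for x t y r
    using assms(2) set_zip_rightD[OF that(1)] set_zip_rightD[OF that(2)] .
  have "same_pattern (xs @ ys) (\<tau> @ \<rho>) \<longleftrightarrow> same_pattern xs \<tau> \<and> same_pattern ys \<rho> \<and>
    (\<forall>(x, t) \<in> set ?A. \<forall>(y, r) \<in> set ?B. (\<bar>x\<bar> < \<bar>y\<bar> \<longleftrightarrow> \<bar>t\<bar> < \<bar>r\<bar>) \<and> (\<bar>y\<bar> < \<bar>x\<bar> \<longleftrightarrow> \<bar>r\<bar> < \<bar>t\<bar>))"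
    using assms(1) True unfolding same_pattern_def set_zip_append case_prod_unfold ball_Un
    by (simp only: length_append) blast
  also have "\<dots> \<longleftrightarrow> same_pattern xs \<tau> \<and> same_pattern ys \<rho> \<and> (\<forall>x \<in> set xs. \<forall>y \<in> set ys. \<bar>x\<bar> < \<bar>y\<bar>)"
    using below unfolding fst_zip by force
  finally show ?thesis .
qed (use assms(1) in \<open>auto simp: same_pattern_def\<close>)

lemma zero_notin_signed_perm:
  assumes "\<pi> \<in> signed_perms n"
  shows "0 \<notin> set \<pi>"
  using assms unfolding signed_perms_def by force

lemma same_pattern_direct_sum:
  assumes "\<tau> \<in> signed_perms l" "\<rho> \<in> signed_perms m" "length xs = length \<tau>"
  shows "same_pattern (xs @ ys) (\<tau> \<oplus> \<rho>) \<longleftrightarrow>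
    same_pattern xs \<tau> \<and> same_pattern ys \<rho> \<and> (\<forall>x \<in> set xs. \<forall>y \<in> set ys. \<bar>x\<bar> < \<bar>y\<bar>)"
proof -
  define \<rho>' where "\<rho>' = map (\<lambda>y. y + sgn y * int (length \<tau>)) \<rho>"
  have abs_le: "\<bar>x\<bar> \<le> int (length \<tau>)" if "x \<in> set \<tau>" for x
    using assms(1) that unfolding signed_perms_def by force
  have shift: "\<bar>y + sgn y * int (length \<tau>)\<bar> = \<bar>y\<bar> + int (length \<tau>)"
    "\<bar>y\<bar> > 0" "0 < y + sgn y * int (length \<tau>) \<longleftrightarrow> 0 < y" if "y \<in> set \<rho>" for y
    using zero_notin_signed_perm[OF assms(2)] that
    by (cases y "0 :: int" rule: linorder_cases; auto)+
  have "\<bar>x\<bar> < \<bar>y\<bar>" if "x \<in> set \<tau>" "y \<in> set \<rho>'" for x y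
    using that abs_le shift unfolding \<rho>'_def by fastforce
  moreover have "same_pattern ys \<rho>' \<longleftrightarrow> same_pattern ys \<rho>"
    unfolding same_pattern_iff_nth \<rho>'_def using shift by (auto simp: nth_mem)
  ultimately show ?thesis
    using same_pattern_append[OF assms(3), of \<rho>' ys] unfolding direct_sum_def \<rho>'_def by simp
qed

lemma occurs_at_length: "occurs_at \<pi> \<tau> ps \<Longrightarrow> length ps = length \<tau>"
  by (simp add: occurs_at_def same_pattern_def)

lemma occurs_at_less_length: "occurs_at \<pi> \<tau> ps \<Longrightarrow> p \<in> set ps \<Longrightarrow> p < length \<pi>"
  unfolding occurs_at_def by blast

lemma occurs_at_iff_nth:
  "occurs_at \<pi> \<tau> ps \<longleftrightarrow> length ps = length \<tau> \<and>
     (\<forall>a < length \<tau>. ps ! a < length \<pi> \<and> (0 < \<pi> ! (ps ! a) \<longleftrightarrow> 0 < \<tau> ! a)) \<and>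
     (\<forall>a < length \<tau>. \<forall>b < length \<tau>. (ps ! a < ps ! b \<longleftrightarrow> a < b) \<and>
        (\<bar>\<pi> ! (ps ! a)\<bar> < \<bar>\<pi> ! (ps ! b)\<bar> \<longleftrightarrow> \<bar>\<tau> ! a\<bar> < \<bar>\<tau> ! b\<bar>))"
proof -
  have "sorted_wrt (<) ps \<longleftrightarrow> (\<forall>a < length ps. \<forall>b < length ps. ps ! a < ps ! b \<longleftrightarrow> a < b)"
    unfolding sorted_wrt_iff_nth_less using strict_mono_on_less[of "{..<length ps}" "(!) ps"]
    by (auto simp: strict_mono_on_def)
  moreover have "set ps \<subseteq> {..<length \<pi>} \<longleftrightarrow> (\<forall>a < length ps. ps ! a < length \<pi>)"
    by (simp add: subset_eq all_set_conv_all_nth)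
  ultimately show ?thesis
    unfolding occurs_at_def same_pattern_iff_nth by auto
qed

lemma sp_contains_iff_occurs_at: "sp_contains \<pi> \<tau> \<longleftrightarrow> (\<exists>ps. occurs_at \<pi> \<tau> ps)"
proof
  assume "sp_contains \<pi> \<tau>"
  then obtain f :: "nat \<Rightarrow> nat" where "strict_mono_on {..<length \<tau>} f"
    "f ` {..<length \<tau>} \<subseteq> {..<length \<pi>}"
    "\<forall>a < length \<tau>. \<forall>b < length \<tau>. \<bar>\<pi> ! f a\<bar> < \<bar>\<pi> ! f b\<bar> \<longleftrightarrow> \<bar>\<tau> ! a\<bar> < \<bar>\<tau> ! b\<bar>"
    "\<forall>a < length \<tau>. \<pi> ! f a > 0 \<longleftrightarrow> \<tau> ! a > 0"
    unfolding sp_contains_def by blast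
  then have "occurs_at \<pi> \<tau> (map f [0..<length \<tau>])"
    by (auto simp: occurs_at_iff_nth strict_mono_on_less)
  then show "\<exists>ps. occurs_at \<pi> \<tau> ps" ..
next
  assume "\<exists>ps. occurs_at \<pi> \<tau> ps"
  then obtain ps where "occurs_at \<pi> \<tau> ps" ..
  then show "sp_contains \<pi> \<tau>"
    unfolding sp_contains_def occurs_at_iff_nth strict_mono_on_def
    by (intro exI[of _ "(!) ps"]) auto
qed

lemma occurs_at_direct_sum_iff:
  assumes "\<tau> \<in> signed_perms l" "\<rho> \<in> signed_perms m" "length ps = length \<tau>"
  shows "occurs_at \<pi> (\<tau> \<oplus> \<rho>) (ps @ qs) \<longleftrightarrow>
    occurs_at \<pi> \<tau> ps \<and> occurs_at \<pi> \<rho> qs \<and> (\<forall>p \<in> set ps. \<forall>q \<in> set qs. south_west \<pi> p q)"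
  using assms
  by (auto simp: occurs_at_def sorted_wrt_append same_pattern_direct_sum south_west_def)

lemma sp_contains_direct_sum_iff:
  assumes "\<tau> \<in> signed_perms l" "\<rho> \<in> signed_perms m"
  shows "sp_contains \<pi> (\<tau> \<oplus> \<rho>) \<longleftrightarrow>
    (\<exists>ps qs. occurs_at \<pi> \<tau> ps \<and> occurs_at \<pi> \<rho> qs \<and>
      (\<forall>p \<in> set ps. \<forall>q \<in> set qs. south_west \<pi> p q))"
proof
  assume "sp_contains \<pi> (\<tau> \<oplus> \<rho>)"
  then obtain rs where rs: "occurs_at \<pi> (\<tau> \<oplus> \<rho>) rs"
    unfolding sp_contains_iff_occurs_at ..
  then have "length (take (length \<tau>) rs) = length \<tau>"
    by (simp add: occurs_at_length direct_sum_def)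
  then show "\<exists>ps qs. occurs_at \<pi> \<tau> ps \<and> occurs_at \<pi> \<rho> qs \<and>
      (\<forall>p \<in> set ps. \<forall>q \<in> set qs. south_west \<pi> p q)"
    using occurs_at_direct_sum_iff[OF assms] rs by (metis append_take_drop_id)
next
  assume "\<exists>ps qs. occurs_at \<pi> \<tau> ps \<and> occurs_at \<pi> \<rho> qs \<and>
      (\<forall>p \<in> set ps. \<forall>q \<in> set qs. south_west \<pi> p q)"
  then obtain ps qs where pqs: "occurs_at \<pi> \<tau> ps" "occurs_at \<pi> \<rho> qs"
    "\<forall>p \<in> set ps. \<forall>q \<in> set qs. south_west \<pi> p q"
    by blast
  then have "length ps = length \<tau>"
    by (simp add: occurs_at_length)
  then show "sp_contains \<pi> (\<tau> \<oplus> \<rho>)"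
    unfolding sp_contains_iff_occurs_at using occurs_at_direct_sum_iff[OF assms] pqs by blast
qed

section \<open>Changing the signs of covered letters\<close>

definition covered :: "int list \<Rightarrow> int list \<Rightarrow> nat \<Rightarrow> bool" where
  "covered \<rho> \<pi> p \<longleftrightarrow> (\<exists>qs. occurs_at \<pi> \<rho> qs \<and> (\<forall>q \<in> set qs. south_west \<pi> p q))"

definition flip_covered :: "int list \<Rightarrow> int list \<Rightarrow> int list" where
  "flip_covered \<rho> \<pi> =
     map (\<lambda>p. if covered \<rho> \<pi> p then - (\<pi> ! p) else \<pi> ! p) [0..<length \<pi>]"

lemma south_west_trans: "south_west \<pi> p q \<Longrightarrow> south_west \<pi> q r \<Longrightarrow> south_west \<pi> p r"
  unfolding south_west_def by linarith

lemma covered_south_west: "south_west \<pi> p q \<Longrightarrow> covered \<rho> \<pi> q \<Longrightarrow> covered \<rho> \<pi> p"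
  unfolding covered_def using south_west_trans by blast

lemma covered_by_uncovered:
  assumes "covered \<rho> \<pi> p"
  shows "\<exists>qs. occurs_at \<pi> \<rho> qs \<and> (\<forall>q \<in> set qs. south_west \<pi> p q \<and> \<not> covered \<rho> \<pi> q)"
  using assms
proof (induction "length \<pi> - p" arbitrary: p rule: less_induct)
  case less
  obtain qs where qs: "occurs_at \<pi> \<rho> qs" "\<forall>q \<in> set qs. south_west \<pi> p q"
    using less.prems unfolding covered_def by blast
  show ?case
  proof (cases "\<exists>q \<in> set qs. covered \<rho> \<pi> q")
    case True
    then obtain q where q: "q \<in> set qs" "covered \<rho> \<pi> q"
      by blast
    have "south_west \<pi> p q"
      using q(1) qs(2) by blast
    moreover have "q < length \<pi>"
      using q(1) qs(1) occurs_at_less_length by blast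
    ultimately have "length \<pi> - q < length \<pi> - p"
      unfolding south_west_def by linarith
    then show ?thesis
      using less.hyps[OF _ q(2)] \<open>south_west \<pi> p q\<close> south_west_trans by blast
  qed (use qs in blast)
qed

lemma occurs_at_uncovered:
  assumes "occurs_at \<pi> \<rho> qs"
  obtains rs where "occurs_at \<pi> \<rho> rs" "\<And>r. r \<in> set rs \<Longrightarrow> \<not> covered \<rho> \<pi> r"
    "\<And>p r. \<forall>q \<in> set qs. south_west \<pi> p q \<Longrightarrow> r \<in> set rs \<Longrightarrow> south_west \<pi> p r"
proof (cases "\<exists>q \<in> set qs. covered \<rho> \<pi> q")
  case True
  then obtain q where "q \<in> set qs" "covered \<rho> \<pi> q"
    by blast
  then show ?thesis
    using covered_by_uncovered[of \<rho> \<pi> q] south_west_trans that by metis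
next
  case False
  then show ?thesis
    using assms that by blast
qed

lemma length_flip_covered [simp]: "length (flip_covered \<rho> \<pi>) = length \<pi>"
  by (simp add: flip_covered_def)

lemma nth_flip_covered:
  "p < length \<pi> \<Longrightarrow> flip_covered \<rho> \<pi> ! p = (if covered \<rho> \<pi> p then - (\<pi> ! p) else \<pi> ! p)"
  by (simp add: flip_covered_def)

lemma map_abs_flip_covered [simp]: "map abs (flip_covered \<rho> \<pi>) = map abs \<pi>"
  by (rule nth_equalityI) (simp_all add: nth_flip_covered)

lemma flip_covered_signed_perms:
  "\<pi> \<in> signed_perms n \<Longrightarrow> flip_covered \<rho> \<pi> \<in> signed_perms n"
  unfolding signed_perms_def by (simp del: set_map)

lemma south_west_flip_covered:
  assumes "p < length \<pi>" "q < length \<pi>"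
  shows "south_west (flip_covered \<rho> \<pi>) p q \<longleftrightarrow> south_west \<pi> p q"
  using assms by (simp add: south_west_def nth_flip_covered)

lemma occurs_at_flip_covered_if_uncovered:
  assumes "\<And>q. q \<in> set qs \<Longrightarrow> \<not> covered \<rho> \<pi> q"
  shows "occurs_at (flip_covered \<rho> \<pi>) \<tau> qs \<longleftrightarrow> occurs_at \<pi> \<tau> qs"
proof -
  have "map ((!) (flip_covered \<rho> \<pi>)) qs = map ((!) \<pi>) qs" if "set qs \<subseteq> {..<length \<pi>}"
    using that assms by (auto simp: nth_flip_covered)
  then show ?thesis
    unfolding occurs_at_def by (metis length_flip_covered)
qed

lemma covered_flip_covered:
  assumes "p < length \<pi>"
  shows "covered \<rho> (flip_covered \<rho> \<pi>) p \<longleftrightarrow> covered \<rho> \<pi> p"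
proof
  assume "covered \<rho> (flip_covered \<rho> \<pi>) p"
  then obtain qs where qs: "occurs_at (flip_covered \<rho> \<pi>) \<rho> qs" "\<forall>q \<in> set qs. south_west \<pi> p q"
    unfolding covered_def
    using south_west_flip_covered[OF assms] occurs_at_less_length by (metis length_flip_covered)
  show "covered \<rho> \<pi> p"
  proof (cases "\<exists>q \<in> set qs. covered \<rho> \<pi> q")
    case True
    then show ?thesis
      using qs(2) covered_south_west by blast
  next
    case False
    then show ?thesis
      using qs occurs_at_flip_covered_if_uncovered unfolding covered_def by blast
  qed
next
  assume "covered \<rho> \<pi> p"
  then obtain qs where qs: "occurs_at \<pi> \<rho> qs"
    "\<forall>q \<in> set qs. south_west \<pi> p q \<and> \<not> covered \<rho> \<pi> q"
    using covered_by_uncovered by blast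
  then have "\<forall>q \<in> set qs. south_west (flip_covered \<rho> \<pi>) p q"
    using south_west_flip_covered[OF assms] occurs_at_less_length by blast
  moreover have "occurs_at (flip_covered \<rho> \<pi>) \<rho> qs"
    using qs occurs_at_flip_covered_if_uncovered by blast
  ultimately show "covered \<rho> (flip_covered \<rho> \<pi>) p"
    unfolding covered_def by blast
qed

lemma flip_covered_flip_covered [simp]: "flip_covered \<rho> (flip_covered \<rho> \<pi>) = \<pi>"
  by (rule nth_equalityI) (simp_all add: nth_flip_covered covered_flip_covered)

lemma occurs_at_flip_covered_if_covered:
  assumes "0 \<notin> set \<pi>" "0 \<notin> set \<tau>" "occurs_at \<pi> \<tau> ps" "\<And>p. p \<in> set ps \<Longrightarrow> covered \<rho> \<pi> p"
  shows "occurs_at (flip_covered \<rho> \<pi>) (bar \<tau>) ps"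
proof -
  have ps: "p < length \<pi>" if "p \<in> set ps" for p
    using assms(3) that by (rule occurs_at_less_length)
  have "map ((!) (flip_covered \<rho> \<pi>)) ps = bar (map ((!) \<pi>) ps)"
    using assms(4) ps by (simp add: bar_def nth_flip_covered)
  moreover have "0 \<notin> set (map ((!) \<pi>) ps)"
    using assms(1) ps nth_mem by fastforce
  ultimately show ?thesis
    using assms(2,3) same_pattern_bar unfolding occurs_at_def by simp
qed

lemma sp_contains_flip_covered:
  assumes "\<tau> \<in> signed_perms l" "\<rho> \<in> signed_perms m" "\<pi> \<in> signed_perms n"
    and "sp_contains \<pi> (\<tau> \<oplus> \<rho>)"
  shows "sp_contains (flip_covered \<rho> \<pi>) (bar \<tau> \<oplus> \<rho>)"
proof -
  let ?\<pi>' = "flip_covered \<rho> \<pi>"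
  obtain ps qs where ps: "occurs_at \<pi> \<tau> ps" and qs: "occurs_at \<pi> \<rho> qs"
    and ps_qs: "\<forall>p \<in> set ps. \<forall>q \<in> set qs. south_west \<pi> p q"
    using assms(4) sp_contains_direct_sum_iff[OF assms(1,2)] by blast
  obtain rs where rs: "occurs_at \<pi> \<rho> rs" "\<And>r. r \<in> set rs \<Longrightarrow> \<not> covered \<rho> \<pi> r"
    and ps_rs: "\<And>p r. p \<in> set ps \<Longrightarrow> r \<in> set rs \<Longrightarrow> south_west \<pi> p r"
    using occurs_at_uncovered[OF qs] ps_qs by metis
  have "covered \<rho> \<pi> p" if "p \<in> set ps" for p
    using that qs ps_qs unfolding covered_def by blast
  then have "occurs_at ?\<pi>' (bar \<tau>) ps"
    using occurs_at_flip_covered_if_covered zero_notin_signed_perm assms(1,3) ps by blast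
  moreover have "occurs_at ?\<pi>' \<rho> rs"
    using rs occurs_at_flip_covered_if_uncovered by blast
  moreover have "\<forall>p \<in> set ps. \<forall>r \<in> set rs. south_west ?\<pi>' p r"
    using occurs_at_less_length[OF ps] occurs_at_less_length[OF rs(1)] ps_rs
    by (simp add: south_west_flip_covered)
  ultimately show ?thesis
    using sp_contains_direct_sum_iff[OF bar_signed_perms[OF assms(1)] assms(2)] by blast
qed

lemma sp_contains_flip_covered_iff:
  assumes "\<tau> \<in> signed_perms l" "\<rho> \<in> signed_perms m" "\<pi> \<in> signed_perms n"
  shows "sp_contains (flip_covered \<rho> \<pi>) (bar \<tau> \<oplus> \<rho>) \<longleftrightarrow> sp_contains \<pi> (\<tau> \<oplus> \<rho>)"
proof
  have "bar (bar \<tau>) = \<tau>"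
    by (simp add: bar_def comp_def)
  then show "sp_contains \<pi> (\<tau> \<oplus> \<rho>)" if "sp_contains (flip_covered \<rho> \<pi>) (bar \<tau> \<oplus> \<rho>)"
    using sp_contains_flip_covered[OF bar_signed_perms[OF assms(1)] assms(2)
        flip_covered_signed_perms[OF assms(3)] that]
    by simp
qed (rule sp_contains_flip_covered[OF assms])

lemma card_avoiders_bar_direct_sum:
  assumes "\<tau> \<in> signed_perms l" "\<rho> \<in> signed_perms m" "M \<subseteq> signed_perms n"
    and closed: "\<And>\<pi>. \<pi> \<in> M \<Longrightarrow> flip_covered \<rho> \<pi> \<in> M"
  shows "card (avoiders M (\<tau> \<oplus> \<rho>)) = card (avoiders M (bar \<tau> \<oplus> \<rho>))"
proof (rule bij_betw_same_card, rule bij_betw_byWitness[where f' = "flip_covered \<rho>"])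
  have contains_iff: "sp_contains (flip_covered \<rho> \<pi>) (bar \<tau> \<oplus> \<rho>) \<longleftrightarrow> sp_contains \<pi> (\<tau> \<oplus> \<rho>)"
    if "\<pi> \<in> M" for \<pi>
    using sp_contains_flip_covered_iff assms(1-3) that by blast
  show "flip_covered \<rho> ` avoiders M (\<tau> \<oplus> \<rho>) \<subseteq> avoiders M (bar \<tau> \<oplus> \<rho>)"
    using contains_iff closed unfolding avoiders_def by auto
  show "flip_covered \<rho> ` avoiders M (bar \<tau> \<oplus> \<rho>) \<subseteq> avoiders M (\<tau> \<oplus> \<rho>)"
    using contains_iff[OF closed] closed unfolding avoiders_def by auto
qed simp_all

section \<open>Signed involutions\<close>

definition underlying_perm :: "int list \<Rightarrow> nat \<Rightarrow> nat" where
  "underlying_perm \<pi> p = nat \<bar>\<pi> ! p\<bar> - 1"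

lemma signed_perm_abs_nth:
  assumes "\<pi> \<in> signed_perms n" "p < n"
  shows "\<bar>\<pi> ! p\<bar> = int (underlying_perm \<pi> p) + 1" "underlying_perm \<pi> p < n"
proof -
  have "\<pi> ! p \<in> set \<pi>"
    using assms by (simp add: signed_perms_def)
  then have "\<bar>\<pi> ! p\<bar> \<in> {1..int n}"
    using assms(1) unfolding signed_perms_def by force
  then show "\<bar>\<pi> ! p\<bar> = int (underlying_perm \<pi> p) + 1" "underlying_perm \<pi> p < n"
    unfolding underlying_perm_def by auto
qed

lemma signed_perm_abs_less_iff:
  assumes "\<pi> \<in> signed_perms n" "p < n" "q < n"
  shows "\<bar>\<pi> ! p\<bar> < \<bar>\<pi> ! q\<bar> \<longleftrightarrow> underlying_perm \<pi> p < underlying_perm \<pi> q"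
  using signed_perm_abs_nth(1)[OF assms(1,2)] signed_perm_abs_nth(1)[OF assms(1,3)] by linarith

lemma sp_fun_eq_sgn: "i \<noteq> 0 \<Longrightarrow> sp_fun \<pi> i = sgn i * \<pi> ! (nat \<bar>i\<bar> - 1)"
  by (auto simp: sp_fun_def)

lemma sp_fun_sp_fun_eq_iff:
  assumes "\<pi> \<in> signed_perms n" "p < n" "\<bar>i\<bar> = int p + 1"
  shows "sp_fun \<pi> (sp_fun \<pi> i) = i \<longleftrightarrow>
    underlying_perm \<pi> (underlying_perm \<pi> p) = p \<and> sgn (\<pi> ! underlying_perm \<pi> p) = sgn (\<pi> ! p)"
proof -
  let ?q = "underlying_perm \<pi> p"
  have abs_nth_p: "\<bar>\<pi> ! p\<bar> = int ?q + 1" and "?q < n"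
    using signed_perm_abs_nth[OF assms(1,2)] .
  then have abs_nth_q: "\<bar>\<pi> ! ?q\<bar> = int (underlying_perm \<pi> ?q) + 1"
    using signed_perm_abs_nth[OF assms(1)] by blast
  have "i \<noteq> 0" "nat \<bar>i\<bar> - 1 = p"
    using assms(3) by auto
  then have sp_fun_i: "sp_fun \<pi> i = sgn i * \<pi> ! p"
    by (simp add: sp_fun_eq_sgn)
  then have "\<bar>sp_fun \<pi> i\<bar> = int ?q + 1"
    using abs_nth_p \<open>i \<noteq> 0\<close> by (simp add: abs_mult)
  then have "sp_fun \<pi> i \<noteq> 0" "nat \<bar>sp_fun \<pi> i\<bar> - 1 = ?q"
    by auto
  then have "sp_fun \<pi> (sp_fun \<pi> i) = sgn (sgn i * \<pi> ! p) * \<pi> ! ?q"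
    using sp_fun_i by (metis sp_fun_eq_sgn)
  then have "sp_fun \<pi> (sp_fun \<pi> i) = sgn i * (sgn (\<pi> ! p) * \<pi> ! ?q)"
    by (simp add: sgn_mult)
  then show ?thesis
    using assms(3) abs_nth_p abs_nth_q by (auto simp: sgn_if split: if_splits)
qed

lemma signed_involutions_iff:
  "\<pi> \<in> signed_involutions n \<longleftrightarrow> \<pi> \<in> signed_perms n \<and>
     (\<forall>p<n. underlying_perm \<pi> (underlying_perm \<pi> p) = p \<and>
        sgn (\<pi> ! underlying_perm \<pi> p) = sgn (\<pi> ! p))"
proof (cases "\<pi> \<in> signed_perms n")
  case True
  note fixed_iff = sp_fun_sp_fun_eq_iff[OF True]
  have "(\<forall>i \<in> {- int n..int n} - {0}. sp_fun \<pi> (sp_fun \<pi> i) = i) \<longleftrightarrow>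
    (\<forall>p<n. underlying_perm \<pi> (underlying_perm \<pi> p) = p \<and>
       sgn (\<pi> ! underlying_perm \<pi> p) = sgn (\<pi> ! p))"
    (is "?involutive \<longleftrightarrow> ?symmetric")
  proof
    assume ?involutive
    then show ?symmetric
      using fixed_iff[of _ "int _ + 1"] by auto
  next
    assume symmetric: ?symmetric
    show ?involutive
    proof
      fix i assume "i \<in> {- int n..int n} - {0}"
      then have "nat \<bar>i\<bar> - 1 < n" "\<bar>i\<bar> = int (nat \<bar>i\<bar> - 1) + 1"
        by auto
      then show "sp_fun \<pi> (sp_fun \<pi> i) = i"
        using fixed_iff symmetric by blast
    qed
  qed
  then show ?thesis
    using True unfolding signed_involutions_def by simp
qed (simp add: signed_involutions_def)

lemma signed_involutionD:
  assumes "\<pi> \<in> signed_involutions n"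
  shows "\<pi> \<in> signed_perms n" "length \<pi> = n"
    and "p < n \<Longrightarrow> underlying_perm \<pi> p < n"
    and "p < n \<Longrightarrow> underlying_perm \<pi> (underlying_perm \<pi> p) = p"
    and "p < n \<Longrightarrow> sgn (\<pi> ! underlying_perm \<pi> p) = sgn (\<pi> ! p)"
    and "p < n \<Longrightarrow> q < n \<Longrightarrow> \<bar>\<pi> ! p\<bar> < \<bar>\<pi> ! q\<bar> \<longleftrightarrow> underlying_perm \<pi> p < underlying_perm \<pi> q"
  using assms signed_perm_abs_nth(2)[of \<pi> n p] signed_perm_abs_less_iff[of \<pi> n p q]
  by (simp_all add: signed_involutions_iff) (simp add: signed_perms_def)

text \<open>The reflected copy of \<open>\<rho>\<close> is a copy of the inverse of \<open>\<rho>\<close>, hence of \<open>\<rho>\<close>.\<close>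

lemma occurs_at_reflected:
  assumes "\<pi> \<in> signed_involutions n" "\<rho> \<in> signed_involutions m" "occurs_at \<pi> \<rho> qs"
  shows "occurs_at \<pi> \<rho> (map (\<lambda>a. underlying_perm \<pi> (qs ! underlying_perm \<rho> a)) [0..<m])"
proof -
  note \<pi> = signed_involutionD[OF assms(1)] and \<rho> = signed_involutionD[OF assms(2)]
  let ?q = "\<lambda>a. qs ! underlying_perm \<rho> a"
  have qs_less: "qs ! a < n" and qs_sign: "0 < \<pi> ! (qs ! a) \<longleftrightarrow> 0 < \<rho> ! a" if "a < m" for a
    using assms(3) that unfolding occurs_at_iff_nth \<pi>(2) \<rho>(2) by blast+
  have qs_mono: "qs ! a < qs ! b \<longleftrightarrow> a < b"
    and qs_abs: "\<bar>\<pi> ! (qs ! a)\<bar> < \<bar>\<pi> ! (qs ! b)\<bar> \<longleftrightarrow> \<bar>\<rho> ! a\<bar> < \<bar>\<rho> ! b\<bar>"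
    if "a < m" "b < m" for a b
    using assms(3) that unfolding occurs_at_iff_nth \<pi>(2) \<rho>(2) by blast+
  have "underlying_perm \<pi> (?q a) < underlying_perm \<pi> (?q b) \<longleftrightarrow> a < b" if "a < m" "b < m" for a b
    using qs_abs[of "underlying_perm \<rho> a" "underlying_perm \<rho> b"] that
    by (simp add: \<pi>(6) \<rho>(3,4,6) qs_less)
  moreover have "\<bar>\<pi> ! underlying_perm \<pi> (?q a)\<bar> < \<bar>\<pi> ! underlying_perm \<pi> (?q b)\<bar> \<longleftrightarrow>
      \<bar>\<rho> ! a\<bar> < \<bar>\<rho> ! b\<bar>"
    if "a < m" "b < m" for a b
    using that by (simp add: \<pi>(3,4,6) \<rho>(3,6) qs_less qs_mono)
  moreover have "0 < \<pi> ! underlying_perm \<pi> (?q a) \<longleftrightarrow> 0 < \<rho> ! a" if "a < m" for a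
    using that \<pi>(5) \<rho>(3,5) qs_less qs_sign by (metis sgn_greater)
  moreover have "underlying_perm \<pi> (?q a) < n" if "a < m" for a
    using that by (simp add: \<pi>(3) \<rho>(3) qs_less)
  ultimately show ?thesis
    by (simp add: occurs_at_iff_nth \<pi>(2) \<rho>(2))
qed

lemma south_west_underlying:
  assumes "\<pi> \<in> signed_involutions n" "q < n" "south_west \<pi> p q"
  shows "south_west \<pi> (underlying_perm \<pi> p) (underlying_perm \<pi> q)"
proof -
  have "p < n"
    using assms(2,3) unfolding south_west_def by linarith
  then show ?thesis
    using assms(2,3) by (simp add: south_west_def signed_involutionD(3,4,6)[OF assms(1)])
qed

lemma covered_underlying:
  assumes "\<pi> \<in> signed_involutions n" "\<rho> \<in> signed_involutions m" "covered \<rho> \<pi> p"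
  shows "covered \<rho> \<pi> (underlying_perm \<pi> p)"
proof -
  obtain qs where qs: "occurs_at \<pi> \<rho> qs" "\<forall>q \<in> set qs. south_west \<pi> p q"
    using assms(3) unfolding covered_def by blast
  have "south_west \<pi> (underlying_perm \<pi> p) (underlying_perm \<pi> (qs ! underlying_perm \<rho> a))"
    if "a < m" for a
  proof -
    have "qs ! underlying_perm \<rho> a \<in> set qs"
      using that signed_involutionD(2,3)[OF assms(2)] occurs_at_length[OF qs(1)] by simp
    moreover from this have "qs ! underlying_perm \<rho> a < n"
      using occurs_at_less_length[OF qs(1)] signed_involutionD(2)[OF assms(1)] by simp
    ultimately show ?thesis
      using qs(2) south_west_underlying[OF assms(1)] by blast
  qed
  then show ?thesis
    using occurs_at_reflected[OF assms(1,2) qs(1)] unfolding covered_def by fastforce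
qed

lemma flip_covered_signed_involutions:
  assumes "\<pi> \<in> signed_involutions n" "\<rho> \<in> signed_involutions m"
  shows "flip_covered \<rho> \<pi> \<in> signed_involutions n"
proof -
  note \<pi> = signed_involutionD[OF assms(1)]
  let ?\<pi>' = "flip_covered \<rho> \<pi>"
  have underlying_flip: "underlying_perm ?\<pi>' p = underlying_perm \<pi> p" if "p < n" for p
    using that \<pi>(2) by (simp add: underlying_perm_def nth_flip_covered)
  have "covered \<rho> \<pi> (underlying_perm \<pi> p) \<longleftrightarrow> covered \<rho> \<pi> p" if "p < n" for p
    using covered_underlying[OF assms] \<pi>(4)[OF that] by metis
  then have "sgn (?\<pi>' ! underlying_perm \<pi> p) = sgn (?\<pi>' ! p)" if "p < n" for p
    using that \<pi>(2,3,5) by (simp add: nth_flip_covered sgn_minus)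
  then show ?thesis
    using flip_covered_signed_perms[OF \<pi>(1)] \<pi>(3,4) underlying_flip
    by (simp add: signed_involutions_iff)
qed

lemma upto_signed_involutions: "[1..int m] \<in> signed_involutions m"
proof -
  have "map abs [1..int m] = [1..int m]"
    by (rule map_idI) auto
  then have "[1..int m] \<in> signed_perms m"
    by (simp add: signed_perms_def del: set_map)
  then show ?thesis
    by (simp add: signed_involutions_iff underlying_perm_def nat_add_distrib)
qed

theorem wilf_equivalent_bar_direct_sum:
  assumes "\<tau> \<in> signed_perms l" "\<rho> \<in> signed_perms m"
  shows "wilf_equivalent (\<tau> \<oplus> \<rho>) (bar \<tau> \<oplus> \<rho>)"
  unfolding wilf_equivalent_def
  using card_avoiders_bar_direct_sum[OF assms subset_refl flip_covered_signed_perms] by blast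

theorem card_signed_involution_avoiders_bar_direct_sum:
  assumes "\<tau> \<in> signed_perms l" "\<rho> \<in> signed_involutions m"
  shows "card (avoiders (signed_involutions n) (\<tau> \<oplus> \<rho>)) =
         card (avoiders (signed_involutions n) (bar \<tau> \<oplus> \<rho>))"
proof (rule card_avoiders_bar_direct_sum[OF assms(1)])
  show "\<rho> \<in> signed_perms m" "signed_involutions n \<subseteq> signed_perms n"
    using assms(2) by (auto simp: signed_involutions_def)
qed (rule flip_covered_signed_involutions[OF _ assms(2)])

lemma append_upto_eq_direct_sum:
  assumes "length \<tau> = l" "l \<le> k"
  shows "\<tau> @ [int l + 1..int k] = \<tau> \<oplus> [1..int (k - l)]"
  using assms by (intro nth_equalityI) (auto simp: direct_sum_def nth_append)

theorem theorem2p1: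
  fixes l k :: nat and \<tau> P Q :: "int list"
  assumes "l \<le> k"
    and "\<tau> \<in> signed_perms l"
    and "P = \<tau> @ [int l + 1..int k]"
    and "Q = bar \<tau> @ [int l + 1..int k]"
  shows "wilf_equivalent P Q \<and>
    (\<forall>n\<ge>1. card (avoiders (signed_involutions n) P) = card (avoiders (signed_involutions n) Q))"
proof -
  let ?\<rho> = "[1..int (k - l)]"
  have "length \<tau> = l" "length (bar \<tau>) = l"
    using assms(2) by (simp_all add: signed_perms_def bar_def)
  then have "P = \<tau> \<oplus> ?\<rho>" "Q = bar \<tau> \<oplus> ?\<rho>"
    unfolding assms(3,4) by (simp_all only: append_upto_eq_direct_sum[OF _ assms(1)])
  then show ?thesis
    using wilf_equivalent_bar_direct_sum[OF assms(2)]
      card_signed_involution_avoiders_bar_direct_sum[OF assms(2)]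
      upto_signed_involutions signed_involutionD(1) by metis
qed

end
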